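(* Let $q$ be a prime power not divisible by $2$ or $3$. Fix $d\in\mathbb F_q^\times$ and $t\in\mathbb F_q$. For every odd integer $2m+1$ (with $m\ge0$), the number $N(d,t)$ of symmetric matrices $A\in\mathrm{GL}_{2m+1}(\mathbb F_q)$ with $(\det A,\operatorname{tr}A)=(d,t)$ satisfies $$\left|N(d,t)-\frac{N}{q(q-1)}\right|\le q^{m(m+1)}(q-1)^{m+1},$$ where $N$ is the total number of invertible symmetric $(2m+1)\times(2m+1)$ matrices over $\mathbb F_q$. *)

theory Defs
  imports
    "Jordan_Normal_Form.Determinant"
    "HOL-Number_Theory.Prime_Powers"
    "HOL-Library.Cardinality"
begin

definition trace_mat :: "'a :: comm_monoid_add mat \<Rightarrow> 'a" where
  "trace_mat A = (\<Sum>i<dim_row A. A $$ (i, i))"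

definition symmetric_GL :: "nat \<Rightarrow> 'a :: semiring_1 mat set" where
  "symmetric_GL n = {A \<in> carrier_mat n n. invertible_mat A \<and> transpose_mat A = A}"

end

theory Submission
  imports Defs "HOL-Number_Theory.Residues"
begin

text \<open>
  Detect the trace condition with additive characters. Let \<open>\<psi>\<close> be a nontrivial additive
  character of the field with \<open>q\<close> elements, and let \<open>S\<^sub>n(d)\<close> be the sum of \<open>\<psi> (tr A)\<close> over the
  symmetric \<open>n \<times> n\<close> matrices \<open>A\<close> with \<open>det A = d\<close>. Orthogonality writes \<open>q \<cdot> N(d,t)\<close> as a sum over
  \<open>a\<close> of twists of \<open>S\<^sub>n(d)\<close> by the characters \<open>x \<mapsto> \<psi> (a * x)\<close>. The term \<open>a = 0\<close> is the number of
  symmetric matrices of determinant \<open>d\<close>; for odd \<open>n\<close> it does not depend on \<open>d \<noteq> 0\<close>, as a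
  congruence combined with a scalar multiplication changes the determinant by any prescribed
  factor (\<open>card_symmetric_GL\<close>). So it equals \<open>N / (q - 1)\<close>, and everything reduces to
  the bound \<open>\<bar>S\<^sub>2\<^sub>m\<^sub>+\<^sub>1(d)\<bar> \<le> q ^ (m * (m + 1)) * (q - 1) ^ m\<close>, for every nontrivial \<open>\<psi>\<close>
  (\<open>norm_det_trace_sum_le\<close>). The \<open>q - 1\<close> nontrivial twists then contribute at most
  \<open>q ^ (m * (m + 1)) * (q - 1) ^ (m + 1) / q\<close> to \<open>N(d,t)\<close>.

  For the bound, split off the first row and column, with corner entry \<open>a\<close>, border vector \<open>b\<close> and
  remaining block \<open>C\<close>. Adding multiples of the first row and column to the others preserves the
  determinant. If \<open>a = 0\<close>, this translates \<open>C\<close> by matrices whose traces are arbitrary when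
  \<open>b \<noteq> 0\<close>, so the sum over \<open>C\<close> vanishes. If \<open>a \<noteq> 0\<close>, completing the square turns the determinant
  into \<open>a * det C\<close> and the trace into \<open>a + tr C + (b \<bullet> b) / a\<close>, and the sum over \<open>b\<close> is an \<open>n\<close>-th
  power of a quadratic Gauss sum. Hence \<open>S\<^sub>n\<^sub>+\<^sub>1(d)\<close> is a sum over \<open>a \<noteq> 0\<close> of \<open>S\<^sub>n(d / a)\<close> with
  explicit coefficients (\<open>det_trace_sum_Suc\<close>).

  Taking absolute values in this recursion would lose too much. For odd \<open>n\<close>, however, composing two
  steps produces as coefficient of \<open>S\<^sub>n(d / c)\<close> a power of the Gauss sum \<open>g\<close> times a Salie sum
  (\<open>det_trace_sum_Suc_Suc\<close>). A Salie sum can be evaluated in closed form: it vanishes unless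
  \<open>c = e\<^sup>2\<close>, when it equals \<open>g * (\<psi> (2 * e) + \<psi> (- 2 * e))\<close>. As half of the \<open>c \<noteq> 0\<close> are squares, the
  absolute values of all Salie sums add up to at most \<open>(q - 1) * \<bar>g\<bar>\<close>, and \<open>\<bar>g\<bar>\<^sup>2 = q\<close>. So a step from \<open>n\<close> to
  \<open>n + 2\<close> costs a factor \<open>q ^ (n + 1) * (q - 1)\<close>, and from \<open>\<bar>S\<^sub>1(d)\<bar> = 1\<close> these
  factors multiply to the bound.
\<close>

section \<open>Additive characters of a finite field\<close>

locale additive_character =
  fixes \<psi> :: "'a :: {field, finite} \<Rightarrow> complex"
  assumes psi_add: "\<psi> (x + y) = \<psi> x * \<psi> y"
    and norm_psi [simp]: "norm (\<psi> x) = 1"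
    and nontrivial: "\<exists>x. \<psi> x \<noteq> 1"
begin

lemma psi_nonzero [simp]: "\<psi> x \<noteq> 0"
  using norm_psi[of x] by (metis norm_zero zero_neq_one)

lemma psi_0 [simp]: "\<psi> 0 = 1"
  using psi_add[of 0 0] by simp

lemma psi_uminus: "\<psi> (- x) = cnj (\<psi> x)"
proof -
  have "\<psi> x * \<psi> (- x) = 1"
    using psi_add[of x "- x"] by simp
  moreover have "\<psi> x * cnj (\<psi> x) = 1"
    by (simp flip: complex_norm_square)
  ultimately show ?thesis
    by (metis mult_cancel_left psi_nonzero)
qed

lemma psi_scale: "a \<noteq> 0 \<Longrightarrow> additive_character (\<lambda>x. \<psi> (a * x))"
proof
  assume "a \<noteq> 0"
  obtain y where "\<psi> y \<noteq> 1" using nontrivial by blast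
  then have "\<psi> (a * (y / a)) \<noteq> 1" using \<open>a \<noteq> 0\<close> by simp
  then show "\<exists>x. \<psi> (a * x) \<noteq> 1" by blast
qed (simp_all add: distrib_left psi_add)

lemma sum_psi: "(\<Sum>x\<in>UNIV. \<psi> x) = 0"
proof -
  obtain y where y: "\<psi> y \<noteq> 1" using nontrivial by blast
  have "(\<Sum>x\<in>UNIV. \<psi> x) = (\<Sum>x\<in>UNIV. \<psi> (x + y))"
    by (rule sum.reindex_bij_betw [symmetric]) (rule bij_plus_right)
  also have "\<dots> = \<psi> y * (\<Sum>x\<in>UNIV. \<psi> x)"
    by (simp add: psi_add sum_distrib_left mult.commute)
  finally show ?thesis using y by simp
qed

lemma sum_psi_mult: "(\<Sum>x\<in>UNIV. \<psi> (c * x)) = (if c = 0 then of_nat CARD('a) else 0)"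
  using additive_character.sum_psi[OF psi_scale, of c] by simp

end

lemma cis_eq_if_cong:
  fixes p k l :: int
  assumes "p > 0" "[k = l] (mod p)"
  shows "cis (2 * pi * k / p) = cis (2 * pi * l / p)"
proof -
  obtain j where "k = l + p * j"
    using cong_sym[OF assms(2)] unfolding cong_iff_lin by blast
  then have "real_of_int k = l + real_of_int p * j" by simp
  then have "2 * pi * k / p = 2 * pi * l / p + 2 * pi * j"
    using assms(1) by (simp add: add_divide_distrib distrib_left)
  then have "cis (2 * pi * k / p) = cis (2 * pi * l / p) * cis (2 * pi * j)"
    by (simp only: cis_mult)
  then show ?thesis by simp
qed

text \<open>
  Among the additive subgroups avoiding \<open>1\<close>, a maximal one \<open>H\<close> is a complement of the prime field:
  for \<open>x \<notin> H\<close>, the subgroup generated by \<open>H\<close> and \<open>x\<close> contains \<open>1\<close>, and since the characteristic \<open>p\<close>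
  is prime, \<open>x\<close> is then congruent to an integer modulo \<open>H\<close>. So the quotient by \<open>H\<close> is cyclic of
  order \<open>p\<close>, and the character sends \<open>x\<close> to a \<open>p\<close>-th root of unity determined by that integer.
\<close>

lemma ex_additive_character: "\<exists>\<psi> :: 'a :: {field, finite} \<Rightarrow> complex. additive_character \<psi>"
proof -
  define p where "p = int CHAR('a)"
  have prime_p: "prime p" unfolding p_def
    using prime_CHAR_semidom[where 'a='a] finite_imp_CHAR_pos[where 'a='a] by simp
  then have p_pos: "p > 0" and p_gt1: "p > 1" by (simp_all add: prime_gt_0_int prime_gt_1_int)
  have of_int_0_iff: "of_int z = (0::'a) \<longleftrightarrow> p dvd z" for z
    unfolding p_def by (rule of_int_eq_0_iff_char_dvd)
  have inv: "\<exists>i. of_int (i * j) = (1::'a)" if "\<not> p dvd j" for j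
  proof -
    have "coprime j p" using prime_imp_coprime[OF prime_p that] by (simp add: coprime_commute)
    then obtain i where "[j * i = 1] (mod p)" using cong_solve_coprime_int by blast
    then have "of_int (j * i - 1) = (0::'a)"
      unfolding of_int_0_iff by (simp add: cong_iff_dvd_diff)
    then show ?thesis by (intro exI[of _ i]) (simp add: mult.commute)
  qed
  \<comment> \<open>closure under subtraction implies closure under integer multiples; so a subgroup
    that contains an integer prime to \<open>p\<close> contains \<open>1\<close>\<close>
  define P where "P H \<longleftrightarrow> 0 \<in> H \<and> (\<forall>x\<in>H. \<forall>y\<in>H. x - y \<in> H) \<and> 1 \<notin> H" for H :: "'a set"
  have "P {0}" by (simp add: P_def)
  then obtain H where H: "P H" and max: "\<And>H'. P H' \<Longrightarrow> H \<subseteq> H' \<Longrightarrow> H' = H"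
    using finite_has_maximal2[of "{H. P H}" "{0}"] by auto
  have H0: "0 \<in> H" and Hd: "\<And>x y. x \<in> H \<Longrightarrow> y \<in> H \<Longrightarrow> x - y \<in> H" and H1: "1 \<notin> H"
    using H by (auto simp: P_def)
  have Hu: "- x \<in> H" if "x \<in> H" for x using Hd[OF H0 that] by simp
  have Ha: "x + y \<in> H" if "x \<in> H" "y \<in> H" for x y using Hd[OF that(1) Hu[OF that(2)]] by simp
  have Hnat: "of_nat k * x \<in> H" if "x \<in> H" for k x
    by (induction k) (simp_all add: H0 Ha that distrib_right)
  have Hint: "of_int k * x \<in> H" if "x \<in> H" for k x
    using Hnat[OF that] Hu by (cases k rule: int_cases2) auto
  have Hmod: "p dvd z" if "of_int z \<in> H" for z
    using inv[of z] Hint[OF that] H1 by (metis of_int_mult)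
  have "\<exists>k. x - of_int k \<in> H" for x
  proof (cases "x \<in> H")
    case True
    then show ?thesis by (intro exI[of _ 0]) simp
  next
    case False
    define H' where "H' = {h + of_int j * x | h j. h \<in> H}"
    have sub: "H \<subseteq> H'" 
    proof
      fix h assume "h \<in> H"
      then have "h + of_int 0 * x \<in> H'" unfolding H'_def by blast
      then show "h \<in> H'" by simp
    qed
    have "0 + of_int 1 * x \<in> H'" unfolding H'_def using H0 by blast
    then have "x \<in> H'" by simp
    then have "\<not> P H'" using max[OF _ sub] False by auto
    moreover have "u - v \<in> H'" if uv: "u \<in> H'" "v \<in> H'" for u v
    proof -
      obtain h j h' j' where "u = h + of_int j * x" "h \<in> H" "v = h' + of_int j' * x" "h' \<in> H"
        using uv unfolding H'_def by auto
      then have "u - v = (h - h') + of_int (j - j') * x" "h - h' \<in> H"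
        by (simp_all add: algebra_simps Hd)
      then show ?thesis unfolding H'_def by blast
    qed
    moreover have "0 \<in> H'" using sub H0 by blast
    ultimately have "1 \<in> H'" unfolding P_def by blast
    then obtain h j where "1 = h + of_int j * x" and h: "h \<in> H"
      unfolding H'_def mem_Collect_eq by blast
    then have hj: "h = 1 - of_int j * x" by (metis add_diff_cancel_right')
    have "\<not> p dvd j"
    proof
      assume "p dvd j"
      then have "of_int j = (0::'a)" unfolding of_int_0_iff .
      then show False using hj h H1 by simp
    qed
    from inv[OF this] obtain i where i: "of_int (i * j) = (1::'a)" ..
    have "of_int i * h = of_int i - of_int (i * j) * x"
      unfolding hj by (simp add: algebra_simps)
    then have "x - of_int i = - (of_int i * h)" unfolding i by simp
    then have "x - of_int i \<in> H" using Hu[OF Hint[OF h, of i]] by simp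
    then show ?thesis ..
  qed
  then have "\<forall>x. \<exists>k. x - of_int k \<in> H" ..
  from choice[OF this] obtain k where k: "\<And>x. x - of_int (k x) \<in> H" by blast
  have k_cong: "[k x = l] (mod p)" if "x - of_int l \<in> H" for x l
    using Hmod[of "k x - l"] Hd[OF that k[of x]] by (simp add: cong_iff_dvd_diff)
  define \<psi> where "\<psi> x = cis (2 * pi * k x / p)" for x
  have "additive_character \<psi>"
  proof
    fix x y
    have "x + y - of_int (k x + k y) = (x - of_int (k x)) + (y - of_int (k y))" by simp
    also have "\<dots> \<in> H" by (intro Ha k)
    finally have "[k (x + y) = k x + k y] (mod p)" by (rule k_cong)
    then have "\<psi> (x + y) = cis (2 * pi * (k x + k y) / p)"
      unfolding \<psi>_def by (rule cis_eq_if_cong[OF p_pos])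
    then show "\<psi> (x + y) = \<psi> x * \<psi> y"
      unfolding \<psi>_def by (simp add: cis_mult add_divide_distrib distrib_left)
  next
    show "norm (\<psi> x) = 1" for x by (simp add: \<psi>_def)
  next
    have "[k 1 = 1] (mod p)" by (rule k_cong) (simp add: H0)
    then have "\<psi> 1 = cis (2 * pi * 1 / p)"
      unfolding \<psi>_def using cis_eq_if_cong[OF p_pos, of "k 1" 1] by simp
    moreover have "cis (2 * pi * real 1 / real (nat p)) \<noteq> cis (2 * pi * real 0 / real (nat p))"
      using bij_betw_roots_unity[of "nat p"] p_gt1
      by (auto simp: bij_betw_def dest!: inj_onD[of _ _ 1 0])
    ultimately have "\<psi> 1 \<noteq> 1" using p_pos by simp
    then show "\<exists>x. \<psi> x \<noteq> 1" by blast
  qed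
  then show ?thesis by blast
qed

section \<open>The quadratic character, Gauss sums and Salie sums\<close>

text \<open>
  The quadratic character, with real values so that it can appear in upper bounds.
\<close>

definition qchar :: "'a :: field \<Rightarrow> real" where
  "qchar x = (if x = 0 then 0 else if \<exists>y. x = y\<^sup>2 then 1 else - 1)"

lemma qchar_0 [simp]: "qchar 0 = 0"
  by (simp add: qchar_def)

lemma qchar_square: "y \<noteq> 0 \<Longrightarrow> qchar (y\<^sup>2) = 1"
  by (auto simp: qchar_def)

lemma qchar_1 [simp]: "qchar 1 = 1"
  using qchar_square[of 1] by simp

lemma qchar_cases: "x \<noteq> 0 \<Longrightarrow> qchar x = 1 \<or> qchar x = - 1"
  by (auto simp: qchar_def)

lemma qchar_power_even: "x \<noteq> 0 \<Longrightarrow> even n \<Longrightarrow> qchar x ^ n = 1"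
  using qchar_cases[of x] by auto

lemma qchar_power_odd: "x \<noteq> 0 \<Longrightarrow> odd n \<Longrightarrow> qchar x ^ n = qchar x"
  using qchar_cases[of x] by auto

lemma card_square_roots:
  fixes x :: "'a :: {field, finite}"
  assumes "(2 :: 'a) \<noteq> 0"
  shows "real (card {y. y\<^sup>2 = x}) = 1 + qchar x"
proof (cases "\<exists>y. x = y\<^sup>2")
  case True
  then obtain y where y: "x = y\<^sup>2" by blast
  have "{z. z\<^sup>2 = x} = {y, - y}" using y by (auto simp: power2_eq_iff)
  moreover have "y = - y \<longleftrightarrow> y = 0"
    using assms by (metis add.inverse_neutral eq_neg_iff_add_eq_0 mult_2 no_zero_divisors)
  ultimately show ?thesis using y by (cases "y = 0") (auto simp: qchar_def card_insert_if)
next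
  case False
  then have "{z. z\<^sup>2 = x} = {}" by blast
  moreover have "x \<noteq> 0" using False by (metis zero_power2)
  ultimately show ?thesis using False by (simp add: qchar_def)
qed

text \<open>
  Every \<open>x\<close> has \<open>1 + qchar x\<close> square roots. This is how Gauss sums enter: a sum of \<open>\<psi>\<close> over squares
  becomes a sum of \<open>\<psi>\<close> twisted by the quadratic character.
\<close>

lemma sum_over_squares:
  fixes f :: "'a :: {field, finite} \<Rightarrow> complex"
  assumes "(2 :: 'a) \<noteq> 0"
  shows "(\<Sum>y\<in>UNIV. f (y\<^sup>2)) = (\<Sum>x\<in>UNIV. of_real (1 + qchar x) * f x)"
proof -
  have "(\<Sum>y\<in>UNIV. f (y\<^sup>2)) = (\<Sum>x\<in>UNIV. \<Sum>y\<in>{y\<in>UNIV. y\<^sup>2 = x}. f (y\<^sup>2))"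
    by (rule sum.group [symmetric]) auto
  also have "\<dots> = (\<Sum>x\<in>UNIV. of_nat (card {y. y\<^sup>2 = x}) * f x)"
    by (rule sum.cong) auto
  also have "\<dots> = (\<Sum>x\<in>UNIV. of_real (1 + qchar x) * f x)"
    by (simp flip: card_square_roots[OF assms])
  finally show ?thesis .
qed

lemma sum_qchar:
  assumes "(2 :: 'a) \<noteq> 0"
  shows "(\<Sum>x\<in>(UNIV :: 'a :: {field, finite} set). qchar x) = 0"
proof -
  have "complex_of_real (\<Sum>x\<in>(UNIV :: 'a set). qchar x) = 0"
    using sum_over_squares[OF assms, of "\<lambda>_. 1"] by (simp add: sum.distrib)
  then show ?thesis by (simp only: of_real_eq_0_iff)
qed

lemma bij_mult: "c \<noteq> 0 \<Longrightarrow> bij (\<lambda>x. c * x :: 'a :: field)"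
  by (rule bij_betw_byWitness[of _ "\<lambda>x. x / c"]) auto

text \<open>
  Only the product of two nonsquares needs an argument. For a nonsquare \<open>a\<close>, the terms
  \<open>qchar x + qchar (a * x)\<close> are \<open>0\<close> if \<open>x\<close> is a square and at most \<open>0\<close> otherwise. As their sum over
  all \<open>x\<close> is \<open>0\<close>, each of them is \<open>0\<close>.
\<close>

lemma qchar_mult:
  fixes a b :: "'a :: {field, finite}"
  assumes "(2 :: 'a) \<noteq> 0"
  shows "qchar (a * b) = qchar a * qchar b"
proof -
  have square: "qchar (y\<^sup>2 * c) = qchar c" if "y \<noteq> 0" for y c :: 'a
  proof -
    have "(\<exists>z. y\<^sup>2 * c = z\<^sup>2) \<longleftrightarrow> (\<exists>z. c = z\<^sup>2)"
    proof
      assume "\<exists>z. y\<^sup>2 * c = z\<^sup>2"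
      then obtain z where "y\<^sup>2 * c = z\<^sup>2" by blast
      then have "c = (z / y)\<^sup>2" using that by (simp add: power_divide eq_divide_eq mult.commute)
      then show "\<exists>z. c = z\<^sup>2" by blast
    qed (metis power_mult_distrib)
    then show ?thesis using that by (simp add: qchar_def)
  qed
  have nonsquare: "qchar (a * x) = - qchar x" if a: "qchar a = - 1" for a x :: 'a
  proof -
    have a0: "a \<noteq> 0" using a by auto
    define h where "h x = - (qchar x + qchar (a * x))" for x
    have "(\<Sum>x\<in>UNIV. qchar (a * x)) = (\<Sum>x\<in>UNIV. qchar (x :: 'a))"
      by (rule sum.reindex_bij_betw[OF bij_mult[OF a0]])
    then have "(\<Sum>x\<in>UNIV. h x) = 0"
      unfolding h_def by (simp add: sum_negf sum.distrib sum_qchar[OF assms] sum_subtractf)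
    moreover have "h x \<ge> 0" for x
    proof (cases "x = 0")
      case False
      then show ?thesis
      proof (cases "\<exists>y. x = y\<^sup>2")
        case True
        then obtain y where y: "x = y\<^sup>2" "y \<noteq> 0" using False by auto
        then show ?thesis using square[of y a] a by (simp add: h_def qchar_square mult.commute)
      next
        case False
        then have "qchar x = - 1" using \<open>x \<noteq> 0\<close> by (simp add: qchar_def)
        moreover have "qchar (a * x) \<le> 1" by (simp add: qchar_def)
        ultimately show ?thesis by (simp add: h_def)
      qed
    qed (simp add: h_def)
    ultimately have "h x = 0" by (simp add: sum_nonneg_eq_0_iff)
    then show ?thesis by (simp add: h_def)
  qed
  consider "a = 0" | y where "a = y\<^sup>2" "y \<noteq> 0" | "qchar a = - 1"
    by (metis qchar_def zero_power2)
  then show ?thesis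
    by cases (simp_all add: square qchar_square nonsquare)
qed

lemma qchar_inverse:
  fixes a :: "'a :: {field, finite}"
  assumes "(2 :: 'a) \<noteq> 0"
  shows "qchar (inverse a) = qchar a"
proof (cases "a = 0")
  case False
  then have "qchar (inverse a) * qchar a = 1" by (simp flip: qchar_mult[OF assms])
  then show ?thesis using qchar_cases[OF False] by auto
qed simp

lemma qchar_divide:
  fixes a b :: "'a :: {field, finite}"
  assumes "(2 :: 'a) \<noteq> 0"
  shows "qchar (a / b) = qchar a * qchar b"
  by (simp add: divide_inverse qchar_mult[OF assms] qchar_inverse[OF assms])

locale odd_additive_character = additive_character \<psi>
  for \<psi> :: "'a :: {field, finite} \<Rightarrow> complex" +
  assumes two_nonzero: "(2 :: 'a) \<noteq> 0"
begin

definition gauss_sum :: complex where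
  "gauss_sum = (\<Sum>x\<in>UNIV. of_real (qchar x) * \<psi> x)"

lemma sum_qchar_psi_mult:
  assumes "c \<noteq> 0"
  shows "(\<Sum>x\<in>UNIV. of_real (qchar x) * \<psi> (c * x)) = of_real (qchar c) * gauss_sum"
proof -
  have "(\<Sum>x\<in>UNIV. of_real (qchar x) * \<psi> (c * x))
      = (\<Sum>x\<in>UNIV. of_real (qchar (c * x / c)) * \<psi> (c * x))"
    using assms by simp
  also have "\<dots> = (\<Sum>x\<in>UNIV. of_real (qchar (x / c)) * \<psi> x)"
    by (rule sum.reindex_bij_betw[OF bij_mult[OF assms], of "\<lambda>x. of_real (qchar (x / c)) * \<psi> x"])
  also have "\<dots> = of_real (qchar c) * gauss_sum"
    by (simp add: qchar_divide[OF two_nonzero] gauss_sum_def sum_distrib_left mult_ac)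
  finally show ?thesis .
qed

lemma sum_psi_square:
  assumes "c \<noteq> 0"
  shows "(\<Sum>x\<in>UNIV. \<psi> (c * x\<^sup>2)) = of_real (qchar c) * gauss_sum"
proof -
  have "(\<Sum>x\<in>UNIV. \<psi> (c * x\<^sup>2))
      = (\<Sum>x\<in>UNIV. \<psi> (c * x)) + (\<Sum>x\<in>UNIV. of_real (qchar x) * \<psi> (c * x))"
    by (simp add: sum_over_squares[OF two_nonzero, of "\<lambda>x. \<psi> (c * x)"] distrib_right sum.distrib)
  then show ?thesis using assms by (simp add: sum_psi_mult sum_qchar_psi_mult)
qed

text \<open>
  The product of the Gauss sum with its conjugate is a double sum of \<open>\<psi> (x\<^sup>2 - y\<^sup>2)\<close>. With
  \<open>x = h + y\<close>, the argument becomes \<open>h\<^sup>2 + 2 * h * y\<close>, which is linear in \<open>y\<close>, so that only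
  \<open>h = 0\<close> survives the summation over \<open>y\<close>.
\<close>

lemma norm_gauss_sum: "(norm gauss_sum)\<^sup>2 = real CARD('a)"
proof -
  have g: "gauss_sum = (\<Sum>x\<in>UNIV. \<psi> (x\<^sup>2))"
    using sum_psi_square[of 1] by simp
  have "gauss_sum * cnj gauss_sum = (\<Sum>y\<in>UNIV. \<Sum>x\<in>UNIV. \<psi> (x\<^sup>2) * \<psi> (- (y\<^sup>2)))"
    unfolding g by (simp add: sum_product psi_uminus) (rule sum.swap)
  also have "\<dots> = (\<Sum>y\<in>UNIV. \<Sum>h\<in>UNIV. \<psi> ((h + y)\<^sup>2) * \<psi> (- (y\<^sup>2)))"
    by (intro sum.cong refl sum.reindex_bij_betw [symmetric]) (rule bij_plus_right)
  also have "\<dots> = (\<Sum>y\<in>UNIV. \<Sum>h\<in>UNIV. \<psi> (h\<^sup>2) * \<psi> (2 * h * y))"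
    by (intro sum.cong refl) (simp flip: psi_add add: power2_sum)
  also have "\<dots> = (\<Sum>h\<in>UNIV. \<psi> (h\<^sup>2) * (\<Sum>y\<in>UNIV. \<psi> (2 * h * y)))"
    by (subst sum.swap) (simp add: sum_distrib_left)
  also have "\<dots> = (\<Sum>h\<in>(UNIV :: 'a set). if h = 0 then of_nat CARD('a) else 0)"
    by (intro sum.cong refl) (auto simp: sum_psi_mult two_nonzero)
  also have "\<dots> = of_nat CARD('a)" by simp
  finally have "complex_of_real ((norm gauss_sum)\<^sup>2) = of_real (real CARD('a))"
    by (simp only: complex_norm_square of_real_of_nat_eq)
  then show ?thesis by (simp only: of_real_eq_iff)
qed

definition salie_sum :: "'a \<Rightarrow> complex" where
  "salie_sum c = (\<Sum>x\<in>UNIV - {0}. of_real (qchar x) * \<psi> (x + c / x))"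

end

text \<open>
  The fibres of \<open>y \<mapsto> y + 1 / y\<close>, which reduce Salie sums to Gauss sums. If the fibre contains
  \<open>y\<close>, it is \<open>{y, 1 / y}\<close>, and \<open>u \<plusminus> 2 = (y \<plusminus> 1)\<^sup>2 / y\<close> has the same quadratic character as \<open>y\<close>
  unless it is \<open>0\<close>. If the fibre is empty, the discriminant \<open>(u + 2) * (u - 2)\<close> of
  \<open>y\<^sup>2 - u * y + 1\<close> is a nonsquare, and the two terms on the right cancel.
\<close>

lemma sum_qchar_joukowski_fibre:
  fixes u :: "'a :: {field, finite}"
  assumes two: "(2 :: 'a) \<noteq> 0"
  shows "(\<Sum>y\<in>{y. y \<noteq> 0 \<and> y + 1 / y = u}. qchar y) = qchar (u + 2) + qchar (u - 2)"
proof (cases "\<exists>y. y \<noteq> 0 \<and> y + 1 / y = u")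
  case True
  then obtain y where y: "y \<noteq> 0" and u: "u = y + 1 / y" by blast
  have iff: "z + 1 / z = u \<longleftrightarrow> z = y \<or> z = 1 / y" if "z \<noteq> 0" for z
  proof -
    have "z + 1 / z = u \<longleftrightarrow> (z - y) * (z - 1 / y) = 0"
      using that y unfolding u by (simp add: field_simps)
    then show ?thesis by simp
  qed
  have fibre: "{y. y \<noteq> 0 \<and> y + 1 / y = u} = {y, 1 / y}"
  proof (rule Set.set_eqI)
    show "z \<in> {y. y \<noteq> 0 \<and> y + 1 / y = u} \<longleftrightarrow> z \<in> {y, 1 / y}" for z
      using y by (cases "z = 0") (simp_all add: iff)
  qed
  have "u + 2 = (y + 1)\<^sup>2 / y" "u - 2 = (y - 1)\<^sup>2 / y"
    using y unfolding u by (simp_all add: field_simps power2_eq_square)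
  then have *: "qchar (u + 2) = qchar ((y + 1)\<^sup>2) * qchar y" "qchar (u - 2) = qchar ((y - 1)\<^sup>2) * qchar y"
    by (simp_all add: qchar_divide[OF two])
  have inv: "qchar (1 / y) = qchar y"
    by (simp add: qchar_divide[OF two])
  have four: "qchar (4 :: 'a) = 1"
    using qchar_square[OF two] by simp
  show ?thesis
  proof (cases "y = 1 \<or> y = - 1")
    case True
    then show ?thesis using * fibre two
      by (elim disjE) (simp_all add: four)
  next
    case False
    then have "y \<noteq> 1 / y" using y
      by (simp add: eq_divide_eq) (metis power2_eq_1_iff power2_eq_square)
    moreover have "y + 1 \<noteq> 0" "y - 1 \<noteq> 0" using False by (auto simp: add_eq_0_iff2)
    ultimately show ?thesis using fibre * inv by (simp add: qchar_square)
  qed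
next
  case False
  have "\<not> (\<exists>w. (u + 2) * (u - 2) = w\<^sup>2)"
  proof
    assume "\<exists>w. (u + 2) * (u - 2) = w\<^sup>2"
    then obtain w where w: "(u + 2) * (u - 2) = w\<^sup>2" by blast
    \<comment> \<open>a square root of the discriminant would give a root of \<open>y\<^sup>2 - u * y + 1\<close>\<close>
    define y where "y = (u + w) / 2"
    have "y * (u - y) = (u\<^sup>2 - w\<^sup>2) / 4"
      using two unfolding y_def by (simp add: field_simps power2_eq_square)
    also have "\<dots> = 1"
    proof -
      have four: "(4::'a) \<noteq> 0" using two by (metis mult_2 no_zero_divisors numeral_Bit0 mult_numeral_1_right)
      have "u\<^sup>2 - w\<^sup>2 = 4" unfolding w[symmetric] by (simp add: power2_eq_square algebra_simps)
      then show ?thesis using four by simp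
    qed
    finally have yu: "y * (u - y) = 1" .
    then have "y \<noteq> 0" by auto
    moreover have "y + 1 / y = u" using yu \<open>y \<noteq> 0\<close> by (simp add: field_simps)
    ultimately show False using False by blast
  qed
  then have "qchar ((u + 2) * (u - 2)) = - 1"
    by (metis qchar_def zero_power2)
  then have "qchar (u + 2) * qchar (u - 2) = - 1" by (simp add: qchar_mult[OF two])
  moreover from this have "u + 2 \<noteq> 0" "u - 2 \<noteq> 0" by auto
  ultimately have "qchar (u + 2) + qchar (u - 2) = 0"
    using qchar_cases[of "u + 2"] qchar_cases[of "u - 2"] by auto
  moreover have "{y. y \<noteq> 0 \<and> y + 1 / y = u} = {}" using False by blast
  ultimately show ?thesis by (metis sum.empty)
qed

context odd_additive_character
begin

text \<open>
  The substitution \<open>x \<mapsto> c / x\<close> fixes the argument of \<open>\<psi>\<close> and changes the sign of the quadratic character.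
\<close>

lemma salie_sum_nonsquare:
  assumes "qchar c = - 1"
  shows "salie_sum c = 0"
proof -
  have c: "c \<noteq> 0" using assms by auto
  have "salie_sum c = (\<Sum>x\<in>UNIV - {0}. of_real (qchar (c / x)) * \<psi> (c / x + c / (c / x)))"
    unfolding salie_sum_def
    by (rule sum.reindex_bij_betw [symmetric], rule bij_betw_byWitness[of _ "\<lambda>x. c / x"]) (use c in auto)
  also have "\<dots> = (\<Sum>x\<in>UNIV - {0}. - (of_real (qchar x) * \<psi> (x + c / x)))"
    using c by (intro sum.cong refl) (simp add: qchar_divide[OF two_nonzero] assms add.commute)
  also have "\<dots> = - salie_sum c" by (simp add: salie_sum_def sum_negf)
  finally show ?thesis by simp
qed

text \<open>
  The substitution \<open>x = e * y\<close> makes the argument of \<open>\<psi>\<close> a multiple of \<open>y + 1 / y\<close>. Summing over the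
  fibres of this map leaves two Gauss sums, shifted by \<open>2\<close> and \<open>- 2\<close>.
\<close>

lemma salie_sum_square:
  assumes e: "e \<noteq> 0"
  shows "salie_sum (e\<^sup>2) = gauss_sum * (\<psi> (2 * e) + \<psi> (- 2 * e))"
proof -
  have shift: "(\<Sum>u\<in>UNIV. of_real (qchar (u + s)) * \<psi> (e * u))
      = \<psi> (- s * e) * (of_real (qchar e) * gauss_sum)" for s
  proof -
    have "(\<Sum>u\<in>UNIV. of_real (qchar (u + s)) * \<psi> (e * u))
       = (\<Sum>u\<in>UNIV. \<psi> (- s * e) * (of_real (qchar (u + s)) * \<psi> (e * (u + s))))"
      by (intro sum.cong refl) (simp add: algebra_simps flip: psi_add)
    also have "\<dots> = (\<Sum>u\<in>UNIV. \<psi> (- s * e) * (of_real (qchar u) * \<psi> (e * u)))"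
      by (rule sum.reindex_bij_betw[OF bij_plus_right,
            of "\<lambda>u. \<psi> (- s * e) * (of_real (qchar u) * \<psi> (e * u))"])
    also have "\<dots> = \<psi> (- s * e) * (of_real (qchar e) * gauss_sum)"
      by (simp only: sum_distrib_left [symmetric] sum_qchar_psi_mult[OF e])
    finally show ?thesis .
  qed
  have "salie_sum (e\<^sup>2) = (\<Sum>y\<in>UNIV - {0}. of_real (qchar (e * y)) * \<psi> (e * y + e\<^sup>2 / (e * y)))"
    unfolding salie_sum_def
    by (rule sum.reindex_bij_betw [symmetric], rule bij_betw_byWitness[of _ "\<lambda>x. x / e"]) (use e in auto)
  also have "\<dots> = of_real (qchar e) * (\<Sum>y\<in>UNIV - {0}. of_real (qchar y) * \<psi> (e * (y + 1 / y)))"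
    unfolding sum_distrib_left using e
    by (intro sum.cong refl) (simp add: qchar_mult[OF two_nonzero] power2_eq_square distrib_left)
  also have "(\<Sum>y\<in>UNIV - {0}. of_real (qchar y) * \<psi> (e * (y + 1 / y)))
     = (\<Sum>u\<in>UNIV. \<Sum>y\<in>{y\<in>UNIV - {0}. y + 1 / y = u}. of_real (qchar y) * \<psi> (e * (y + 1 / y)))"
    by (rule sum.group [symmetric]) auto
  also have "\<dots> = (\<Sum>u\<in>UNIV. of_real (\<Sum>y\<in>{y. y \<noteq> 0 \<and> y + 1 / y = u}. qchar y) * \<psi> (e * u))"
    by (intro sum.cong refl) (simp add: sum_distrib_right)
  also have "\<dots> = (\<Sum>u\<in>UNIV. of_real (qchar (u + 2)) * \<psi> (e * u))
      + (\<Sum>u\<in>UNIV. of_real (qchar (u + - 2)) * \<psi> (e * u))"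
    by (simp add: sum_qchar_joukowski_fibre[OF two_nonzero] distrib_right sum.distrib del: of_real_sum)
  also have "\<dots> = of_real (qchar e) * gauss_sum * (\<psi> (2 * e) + \<psi> (- 2 * e))"
    unfolding shift by (simp add: algebra_simps)
  also have "of_real (qchar e) * \<dots> = of_real ((qchar e)\<^sup>2) * (gauss_sum * (\<psi> (2 * e) + \<psi> (- 2 * e)))"
    by (simp add: power2_eq_square mult_ac)
  finally show ?thesis using qchar_power_even[OF e, of 2] by simp
qed

text \<open>
  The factor \<open>1 + qchar c\<close> is \<open>2\<close> or \<open>0\<close>, according to the two evaluations. In this form the bound is
  summed over \<open>c\<close> by the vanishing of the sum of \<open>qchar\<close>.
\<close>

lemma norm_salie_sum_le:
  assumes "c \<noteq> 0"
  shows "norm (salie_sum c) \<le> norm gauss_sum * (1 + qchar c)"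
proof (cases "qchar c = - 1")
  case True
  then show ?thesis by (simp add: salie_sum_nonsquare)
next
  case False
  then obtain e where e: "c = e\<^sup>2" "e \<noteq> 0"
    using assms by (auto simp: qchar_def split: if_splits)
  have "norm (\<psi> (2 * e) + \<psi> (- 2 * e)) \<le> 1 + 1"
    by (rule order_trans[OF norm_triangle_ineq]) simp
  then show ?thesis
    using e by (simp add: salie_sum_square norm_mult qchar_square mult_left_mono)
qed

lemma sum_norm_salie_sum_le:
  "(\<Sum>c\<in>UNIV - {0}. norm (salie_sum c)) \<le> norm gauss_sum * (real CARD('a) - 1)"
proof -
  have "(\<Sum>c\<in>UNIV - {0}. norm (salie_sum c)) \<le> (\<Sum>c\<in>UNIV - {0 :: 'a}. norm gauss_sum * (1 + qchar c))"
    by (intro sum_mono norm_salie_sum_le) simp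
  also have "\<dots> = norm gauss_sum * (\<Sum>c\<in>UNIV - {0 :: 'a}. 1 + qchar c)"
    by (simp add: sum_distrib_left)
  also have "(\<Sum>c\<in>UNIV - {0 :: 'a}. 1 + qchar c) = real CARD('a) - 1"
    using sum_qchar[OF two_nonzero] by (simp add: sum_diff1 sum.distrib)
  finally show ?thesis .
qed

end

section \<open>Symmetric matrices and their bordered form\<close>

definition symmetric_mats :: "nat \<Rightarrow> 'a mat set" where
  "symmetric_mats n = {A \<in> carrier_mat n n. transpose_mat A = A}"

lemma symmetric_mats_iff:
  "A \<in> symmetric_mats n \<longleftrightarrow>
     A \<in> carrier_mat n n \<and> (\<forall>i<n. \<forall>j<n. A $$ (i, j) = A $$ (j, i))"
  unfolding symmetric_mats_def by (auto simp: mat_eq_iff)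

lemma symmetric_mats_carrier: "A \<in> symmetric_mats n \<Longrightarrow> A \<in> carrier_mat n n"
  by (simp add: symmetric_mats_def)

lemma symmetric_GL_eq:
  "symmetric_GL n = {A \<in> symmetric_mats n. det A \<noteq> (0 :: 'a :: field)}"
proof -
  have "invertible_mat A \<longleftrightarrow> det A \<noteq> 0" if A: "A \<in> carrier_mat n n" for A :: "'a mat"
  proof
    assume "invertible_mat A"
    then obtain B where B: "A * B = 1\<^sub>m n" "B * A = 1\<^sub>m (dim_row B)"
      using A by (auto simp: invertible_mat_def inverts_mat_def)
    have "B \<in> carrier_mat n n"
      using arg_cong[OF B(1), of dim_col] arg_cong[OF B(2), of dim_col] A by auto
    from det_mult[OF A this] have "det A * det B = 1" by (simp add: B(1))
    then show "det A \<noteq> 0" by auto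
  next
    assume "det A \<noteq> 0"
    from det_non_zero_imp_unit[OF A this, of "()"] show "invertible_mat A"
      using A by (auto simp: Units_def ring_mat_simps invertible_mat_def inverts_mat_def)
  qed
  then show ?thesis
    unfolding symmetric_GL_def symmetric_mats_def by auto
qed

definition bordered :: "'a \<Rightarrow> 'a vec \<Rightarrow> 'a mat \<Rightarrow> 'a mat" where
  "bordered a b C = four_block_mat (mat 1 1 (\<lambda>_. a)) (mat 1 (dim_vec b) (\<lambda>(_, j). b $ j))
     (mat (dim_vec b) 1 (\<lambda>(i, _). b $ i)) C"

lemma bordered_carrier [simp]:
  "b \<in> carrier_vec n \<Longrightarrow> C \<in> carrier_mat n n \<Longrightarrow> bordered a b C \<in> carrier_mat (Suc n) (Suc n)"
  unfolding bordered_def by auto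

lemma bordered_index:
  assumes "b \<in> carrier_vec n" "C \<in> carrier_mat n n"
  shows "bordered a b C $$ (0, 0) = a"
    and "i < n \<Longrightarrow> bordered a b C $$ (0, Suc i) = b $ i"
    and "i < n \<Longrightarrow> bordered a b C $$ (Suc i, 0) = b $ i"
    and "i < n \<Longrightarrow> j < n \<Longrightarrow> bordered a b C $$ (Suc i, Suc j) = C $$ (i, j)"
  using assms unfolding bordered_def by auto

lemma trace_bordered:
  assumes "b \<in> carrier_vec n" "C \<in> carrier_mat n n"
  shows "trace_mat (bordered a b C) = a + trace_mat C"
proof -
  have "dim_row (bordered a b C) = Suc n" "dim_row C = n"
    using bordered_carrier[OF assms, of a] assms(2) by auto
  then show ?thesis
    unfolding trace_mat_def by (simp only: sum.lessThan_Suc_shift) (simp add: bordered_index[OF assms])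
qed

lemma bij_betw_bordered:
  "bij_betw (\<lambda>(a, b, C). bordered a b C) (UNIV \<times> carrier_vec n \<times> symmetric_mats n)
     (symmetric_mats (Suc n) :: 'a mat set)"
proof (rule bij_betw_byWitness[where f' = "\<lambda>A. (A $$ (0, 0), vec n (\<lambda>i. A $$ (Suc i, 0)),
          mat n n (\<lambda>(i, j). A $$ (Suc i, Suc j)))"])
  show "\<forall>x\<in>UNIV \<times> carrier_vec n \<times> symmetric_mats n.
      (\<lambda>A. (A $$ (0, 0), vec n (\<lambda>i. A $$ (Suc i, 0)), mat n n (\<lambda>(i, j). A $$ (Suc i, Suc j))))
        ((\<lambda>(a, b, C). bordered a b C) x) = (x :: 'a \<times> 'a vec \<times> 'a mat)"
    by (auto simp: bordered_index dest!: symmetric_mats_carrier)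
next
  show "(\<lambda>(a, b, C). bordered a b C) ` (UNIV \<times> carrier_vec n \<times> symmetric_mats n)
      \<subseteq> (symmetric_mats (Suc n) :: 'a mat set)"
    by (auto simp: symmetric_mats_iff less_Suc_eq_0_disj bordered_index)
next
  show "\<forall>A\<in>symmetric_mats (Suc n). (\<lambda>(a, b, C). bordered a b C)
      (A $$ (0, 0), vec n (\<lambda>i. A $$ (Suc i, 0)), mat n n (\<lambda>(i, j). A $$ (Suc i, Suc j))) = (A :: 'a mat)"
  proof
    fix A :: "'a mat" assume A: "A \<in> symmetric_mats (Suc n)"
    have "bordered (A $$ (0, 0)) (vec n (\<lambda>i. A $$ (Suc i, 0))) (mat n n (\<lambda>(i, j). A $$ (Suc i, Suc j))) = A"
      (is "?B = A")
    proof (rule eq_matI)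
      have B: "?B \<in> carrier_mat (Suc n) (Suc n)" by simp
      show "dim_row ?B = dim_row A" "dim_col ?B = dim_col A"
        by (simp_all only: carrier_matD[OF B] carrier_matD[OF symmetric_mats_carrier[OF A]])
      fix i j assume "i < dim_row A" "j < dim_col A"
      then have "i < Suc n" "j < Suc n"
        by (simp_all only: carrier_matD[OF symmetric_mats_carrier[OF A]])
      moreover have "A $$ (0, Suc j) = A $$ (Suc j, 0)" if "j < n" for j
        using A that by (simp add: symmetric_mats_iff)
      ultimately show "?B $$ (i, j) = A $$ (i, j)"
        by (cases i; cases j) (simp_all add: bordered_index[OF vec_carrier mat_carrier])
    qed
    then show "(\<lambda>(a, b, C). bordered a b C)
      (A $$ (0, 0), vec n (\<lambda>i. A $$ (Suc i, 0)), mat n n (\<lambda>(i, j). A $$ (Suc i, Suc j))) = A"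
      by simp
  qed
next
  show "(\<lambda>A. (A $$ (0, 0), vec n (\<lambda>i. A $$ (Suc i, 0)), mat n n (\<lambda>(i, j). A $$ (Suc i, Suc j)))) `
      symmetric_mats (Suc n) \<subseteq> UNIV \<times> carrier_vec n \<times> (symmetric_mats n :: 'a mat set)"
    by (auto simp: symmetric_mats_iff)
qed

lemma bij_betw_vCons:
  "bij_betw (\<lambda>(a, v). vCons a v) (UNIV \<times> carrier_vec n) (carrier_vec (Suc n) :: 'a vec set)"
proof (rule bij_betw_imageI)
  show "inj_on (\<lambda>(a, v). vCons a v) (UNIV \<times> (carrier_vec n :: 'a vec set))"
    by (simp add: inj_on_def)
  have "v \<in> (\<lambda>(a, v). vCons a v) ` (UNIV \<times> carrier_vec n)"
    if v: "v \<in> carrier_vec (Suc n)" for v :: "'a vec"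
  proof (cases v)
    case vNil
    then show ?thesis using carrier_vecD[OF v] by simp
  next
    case (vCons a w)
    then have "(a, w) \<in> UNIV \<times> carrier_vec n" using v by simp
    then show ?thesis using vCons by (intro image_eqI[of _ _ "(a, w)"]) simp_all
  qed
  then show "(\<lambda>(a, v). vCons a v) ` (UNIV \<times> carrier_vec n) = (carrier_vec (Suc n) :: 'a vec set)"
    by auto
qed

lemma carrier_vec_0: "carrier_vec 0 = {vNil}"
proof (intro equalityI subsetI)
  fix v :: "'a vec" assume "v \<in> carrier_vec 0"
  from carrier_vecD[OF this] show "v \<in> {vNil}" by (cases v) simp_all
qed simp

lemma finite_carrier_vec [simp]: "finite (carrier_vec n :: 'a :: finite vec set)"
proof (induction n)
  case 0
  show ?case by (simp add: carrier_vec_0)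
next
  case (Suc n)
  then have "finite ((UNIV :: 'a set) \<times> (carrier_vec n :: 'a vec set))" by (intro finite_cartesian_product) simp
  then show ?case using bij_betw_finite[OF bij_betw_vCons[where 'a='a], of n] by (rule iffD1[rotated])
qed

lemma symmetric_mats_0: "symmetric_mats 0 = {1\<^sub>m 0}"
  by (auto simp: symmetric_mats_iff)

lemma finite_symmetric_mats [simp]: "finite (symmetric_mats n :: 'a :: {zero, one, finite} mat set)"
proof (induction n)
  case 0
  then show ?case by (simp add: symmetric_mats_0)
next
  case (Suc n)
  then have "finite ((UNIV :: 'a set) \<times> (carrier_vec n :: 'a vec set) \<times> (symmetric_mats n :: 'a mat set))"
    by (intro finite_cartesian_product) simp_all
  then show ?case using bij_betw_finite[OF bij_betw_bordered[where 'a='a], of n] by (rule iffD1[rotated])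
qed

lemma sum_symmetric_mats_Suc:
  "(\<Sum>A\<in>symmetric_mats (Suc n). f A)
     = (\<Sum>a\<in>UNIV. \<Sum>b\<in>carrier_vec n. \<Sum>C\<in>symmetric_mats n. f (bordered a b C))"
  unfolding sum.cartesian_product sum.reindex_bij_betw[OF bij_betw_bordered, symmetric]
  by (simp add: split_def)

lemma sum_carrier_vec_Suc:
  "(\<Sum>v\<in>carrier_vec (Suc n). f v) = (\<Sum>a\<in>UNIV. \<Sum>v\<in>carrier_vec n. f (vCons a v))"
  unfolding sum.cartesian_product sum.reindex_bij_betw[OF bij_betw_vCons, symmetric]
  by (simp add: split_def)

text \<open>
  Used to replace the block \<open>C\<close> of a bordered matrix by \<open>C + D\<close>, with \<open>D\<close> chosen so that the
  determinant simplifies.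
\<close>

lemma sum_symmetric_mats_shift:
  fixes f :: "'a :: ab_group_add mat \<Rightarrow> 'b :: comm_monoid_add"
  assumes D: "D \<in> symmetric_mats n"
  shows "(\<Sum>C\<in>symmetric_mats n. f (C + D)) = (\<Sum>C\<in>symmetric_mats n. f C)"
proof (rule sum.reindex_bij_betw, rule bij_betw_byWitness[of _ "\<lambda>C. C - D"])
  show "\<forall>C\<in>symmetric_mats n. C + D - D = C" "\<forall>C\<in>symmetric_mats n. C - D + D = C"
    using D by (auto simp: symmetric_mats_iff intro!: eq_matI)
  show "(\<lambda>C. C + D) ` symmetric_mats n \<subseteq> symmetric_mats n"
    "(\<lambda>C. C - D) ` symmetric_mats n \<subseteq> symmetric_mats n"
    using D by (auto simp: symmetric_mats_iff intro: minus_carrier_mat)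
qed

lemma trace_add:
  "A \<in> carrier_mat n n \<Longrightarrow> B \<in> carrier_mat n n \<Longrightarrow> trace_mat (A + B) = trace_mat A + trace_mat B"
  by (auto simp: trace_mat_def sum.distrib)

text \<open>
  The matrix \<open>w b\<^sup>T + b w\<^sup>T + a w w\<^sup>T\<close>: by it the lower right block of a bordered matrix changes when
  \<open>w\<^sub>i\<close> times the first row is added to row \<open>i + 1\<close> for all \<open>i\<close>, and likewise for the columns.
\<close>

definition congruence_shift :: "'a :: comm_ring_1 \<Rightarrow> 'a vec \<Rightarrow> 'a vec \<Rightarrow> 'a mat" where
  "congruence_shift a b w = mat (dim_vec w) (dim_vec w)
     (\<lambda>(i, j). w $ i * b $ j + b $ i * w $ j + a * (w $ i * w $ j))"

lemma congruence_shift_symmetric: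
  "w \<in> carrier_vec n \<Longrightarrow> congruence_shift a b w \<in> symmetric_mats n"
  by (auto simp: congruence_shift_def symmetric_mats_iff algebra_simps)

lemma trace_congruence_shift:
  assumes w: "w \<in> carrier_vec n" and b: "b \<in> carrier_vec n"
  shows "trace_mat (congruence_shift a b w) = 2 * (w \<bullet> b) + a * (w \<bullet> w)"
proof -
  have dims: "dim_vec w = n" "dim_vec b = n"
    using carrier_vecD[OF w] carrier_vecD[OF b] .
  have "trace_mat (congruence_shift a b w) = (\<Sum>i<n. 2 * (w $ i * b $ i) + a * (w $ i * w $ i))"
    unfolding trace_mat_def congruence_shift_def
    by (rule sum.cong) (simp_all add: dims mult.commute)
  also have "\<dots> = 2 * (w \<bullet> b) + a * (w \<bullet> w)"
    unfolding scalar_prod_def dims atLeast0LessThan sum.distrib sum_distrib_left ..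
  finally show ?thesis .
qed

text \<open>
  The matrix on the left is \<open>P M P\<^sup>T\<close>, where \<open>M\<close> is the matrix on the right and \<open>P\<close> is lower unitriangular
  with first column \<open>(1, w)\<close>.
\<close>

lemma det_bordered_congruence:
  fixes C :: "'a :: field mat"
  assumes b: "b \<in> carrier_vec n" and w: "w \<in> carrier_vec n" and C: "C \<in> carrier_mat n n"
  shows "det (bordered a (b + a \<cdot>\<^sub>v w) (C + congruence_shift a b w)) = det (bordered a b C)"
proof -
  define W where "W = mat n 1 (\<lambda>(i, _). w $ i)"
  define P where "P = four_block_mat (1\<^sub>m 1) (0\<^sub>m 1 n) W (1\<^sub>m n)"
  have W: "W \<in> carrier_mat n 1" by (simp add: W_def)
  have P: "P \<in> carrier_mat (Suc n) (Suc n)" unfolding P_def by (auto simp: W_def)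
  have detP: "det P = 1" unfolding P_def
    by (subst det_four_block_mat_upper_right_zero[of _ 1 _ n]) (auto simp: W_def)
  define r where "r = mat 1 n (\<lambda>(_, j). b $ j)"
  define s where "s = mat n 1 (\<lambda>(i, _). b $ i)"
  define A where "A = mat 1 1 (\<lambda>_::nat \<times> nat. a)"
  have M: "bordered a b C = four_block_mat A r s C"
    using b by (simp add: bordered_def A_def r_def s_def)
  have PM: "P * bordered a b C = four_block_mat A r (W * A + s) (W * r + C)"
    unfolding P_def M
    by (subst mult_four_block_mat[of _ 1 1 _ n _ n _ _ 1 _ n])
      (use C in \<open>auto simp: W_def A_def r_def s_def\<close>)
  have PT: "transpose_mat P = four_block_mat (1\<^sub>m 1) (transpose_mat W) (0\<^sub>m n 1) (1\<^sub>m n)"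
    unfolding P_def by (subst transpose_four_block_mat[of _ 1 1 _ n _ n]) (auto simp: W_def)
  have "P * bordered a b C * transpose_mat P
      = four_block_mat A (A * transpose_mat W + r) (W * A + s)
          ((W * A + s) * transpose_mat W + (W * r + C))"
    unfolding PM PT
    by (subst mult_four_block_mat[of _ 1 1 _ n _ n _ _ 1 _ n])
      (use C in \<open>auto simp: W_def A_def r_def s_def\<close>)
  also have "\<dots> = bordered a (b + a \<cdot>\<^sub>v w) (C + congruence_shift a b w)"
    unfolding bordered_def
    by (rule cong_four_block_mat; rule eq_matI)
      (use b w C in \<open>auto simp: W_def A_def r_def s_def congruence_shift_def scalar_prod_def algebra_simps\<close>)
  finally have "det (bordered a (b + a \<cdot>\<^sub>v w) (C + congruence_shift a b w))
      = det (P * bordered a b C * transpose_mat P)" by simp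
  also have "\<dots> = det P * det (bordered a b C) * det P"
    using P b C by (simp add: det_mult[of _ "Suc n"] det_transpose)
  finally show ?thesis by (simp add: detP)
qed

lemma det_bordered_0:
  fixes C :: "'a :: field mat"
  assumes C: "C \<in> carrier_mat n n"
  shows "det (bordered a (0\<^sub>v n) C) = a * det C"
proof -
  have "bordered a (0\<^sub>v n) C = four_block_mat (mat 1 1 (\<lambda>_. a)) (0\<^sub>m 1 n) (0\<^sub>m n 1) C"
    unfolding bordered_def by (rule cong_four_block_mat; rule eq_matI) auto
  also have "det \<dots> = det (mat 1 1 (\<lambda>_::nat \<times> nat. a)) * det C"
    by (rule det_four_block_mat_upper_right_zero) (use C in auto)
  also have "det (mat 1 1 (\<lambda>_::nat \<times> nat. a)) = a" by (simp add: det_single)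
  finally show ?thesis .
qed

section \<open>Character sums over symmetric matrices of given determinant\<close>

context odd_additive_character
begin

lemma sum_psi_scalar_prod:
  "(\<Sum>v\<in>carrier_vec n. \<psi> (c * (v \<bullet> v))) = (\<Sum>x\<in>UNIV. \<psi> (c * x\<^sup>2)) ^ n"
proof (induction n)
  case 0
  show ?case by (simp add: carrier_vec_0 scalar_prod_def)
next
  case (Suc n)
  have "(\<Sum>v\<in>carrier_vec (Suc n). \<psi> (c * (v \<bullet> v)))
      = (\<Sum>x\<in>UNIV. \<psi> (c * x\<^sup>2) * (\<Sum>v\<in>carrier_vec n. \<psi> (c * (v \<bullet> v))))"
    unfolding sum_carrier_vec_Suc
    by (simp add: distrib_left psi_add sum_distrib_left power2_eq_square)
  then show ?case by (simp add: Suc.IH sum_distrib_right)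
qed

definition det_trace_sum :: "nat \<Rightarrow> 'a \<Rightarrow> complex" where
  "det_trace_sum n d = (\<Sum>A\<in>symmetric_mats n. if det A = d then \<psi> (trace_mat A) else 0)"

text \<open>
  If \<open>b = 0\<close>, the bordered matrix is singular and does not contribute. Otherwise some \<open>w\<close> has
  \<open>2 * (w \<bullet> b) = y\<close> with \<open>\<psi> y \<noteq> 1\<close>. The translation of \<open>C\<close> by \<open>w b\<^sup>T + b w\<^sup>T\<close> permutes the summands
  up to the factor \<open>\<psi> y\<close>, so the sum is \<open>0\<close>.
\<close>

lemma bordered_sum_zero_corner:
  assumes d: "d \<noteq> 0" and b: "b \<in> carrier_vec n"
  shows "(\<Sum>C\<in>symmetric_mats n.
      if det (bordered 0 b C) = d then \<psi> (trace_mat (bordered 0 b C)) else 0) = 0"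
    (is "(\<Sum>C\<in>_. ?F C) = 0")
proof (cases "b = 0\<^sub>v n")
  case True
  have "?F C = 0" if "C \<in> symmetric_mats n" for C
    unfolding True det_bordered_0[OF symmetric_mats_carrier[OF that]] using d by simp
  then show ?thesis by (intro sum.neutral ballI)
next
  case False
  then obtain i where i: "i < n" "b $ i \<noteq> 0"
    using b by (metis carrier_vecD dim_vec index_zero_vec(1) eq_vecI zero_carrier_vec)
  obtain y where y: "\<psi> y \<noteq> 1" using nontrivial by blast
  define w where "w = (y / (2 * b $ i)) \<cdot>\<^sub>v unit_vec n i"
  have w: "w \<in> carrier_vec n" by (simp add: w_def)
  have wb: "2 * (w \<bullet> b) = y"
    using b i two_nonzero by (simp add: w_def smult_scalar_prod_distrib[of _ n] scalar_prod_left_unit)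
  define D where "D = congruence_shift 0 b w"
  have D: "D \<in> symmetric_mats n" unfolding D_def by (rule congruence_shift_symmetric[OF w])
  have "?F (C + D) = \<psi> y * ?F C" if "C \<in> symmetric_mats n" for C
  proof -
    note C = symmetric_mats_carrier[OF that] and D' = symmetric_mats_carrier[OF D]
    have "b + 0 \<cdot>\<^sub>v w = b" using b w by (auto intro!: eq_vecI)
    then have "det (bordered 0 b (C + D)) = det (bordered 0 b C)"
      using det_bordered_congruence[OF b w C, of 0] by (simp add: D_def)
    moreover have "trace_mat (bordered 0 b (C + D)) = y + trace_mat (bordered 0 b C)"
      using trace_congruence_shift[OF w b, of 0] C D'
      by (simp add: trace_bordered[OF b] trace_add[OF C D'[unfolded D_def]] wb D_def)
    ultimately show ?thesis by (simp add: psi_add)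
  qed
  then have "(\<Sum>C\<in>symmetric_mats n. ?F (C + D)) = \<psi> y * (\<Sum>C\<in>symmetric_mats n. ?F C)"
    unfolding sum_distrib_left by (intro sum.cong refl)
  then have "(\<Sum>C\<in>symmetric_mats n. ?F C) = \<psi> y * (\<Sum>C\<in>symmetric_mats n. ?F C)"
    by (simp only: sum_symmetric_mats_shift[OF D, of ?F])
  then show ?thesis using y by simp
qed

text \<open>
  The congruence with \<open>w = b / a\<close> clears the border: the Schur complement of the corner is the new
  variable of summation. The trace of the matrix \<open>b b\<^sup>T / a\<close> by which it differs from \<open>C\<close> accounts for
  the factor \<open>\<psi> ((b \<bullet> b) / a)\<close>.
\<close>

lemma bordered_sum_nonzero_corner:
  assumes a: "a \<noteq> 0" and b: "b \<in> carrier_vec n"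
  shows "(\<Sum>C\<in>symmetric_mats n.
      if det (bordered a b C) = d then \<psi> (trace_mat (bordered a b C)) else 0)
    = \<psi> a * \<psi> (1 / a * (b \<bullet> b)) * det_trace_sum n (d / a)"
    (is "(\<Sum>C\<in>_. ?F C) = _")
proof -
  define w where "w = (1 / a) \<cdot>\<^sub>v b"
  have w: "w \<in> carrier_vec n" using b by (simp add: w_def)
  have ww: "a * (w \<bullet> w) = 1 / a * (b \<bullet> b)"
    using a b by (simp add: w_def smult_scalar_prod_distrib[of _ n] scalar_prod_smult_distrib[of _ n])
  define D where "D = congruence_shift a (0\<^sub>v n) w"
  have D: "D \<in> symmetric_mats n" unfolding D_def by (rule congruence_shift_symmetric[OF w])
  have "?F (C + D) = \<psi> a * \<psi> (1 / a * (b \<bullet> b)) * (if det C = d / a then \<psi> (trace_mat C) else 0)"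
    if "C \<in> symmetric_mats n" for C
  proof -
    note C = symmetric_mats_carrier[OF that] and D' = symmetric_mats_carrier[OF D]
    have "0\<^sub>v n + a \<cdot>\<^sub>v w = b" using a b by (simp add: w_def smult_smult_assoc)
    then have "det (bordered a b (C + D)) = a * det C"
      using det_bordered_congruence[OF zero_carrier_vec w C, of a] det_bordered_0[OF C, of a]
      by (simp add: D_def)
    moreover have "trace_mat (bordered a b (C + D)) = a + 1 / a * (b \<bullet> b) + trace_mat C"
      using trace_congruence_shift[OF w zero_carrier_vec, of a] C D' w
      by (simp add: trace_bordered[OF b] trace_add[OF C D'[unfolded D_def]] ww D_def)
    moreover have "a * det C = d \<longleftrightarrow> det C = d / a" using a by (auto simp: field_simps)
    ultimately show ?thesis by (simp add: psi_add)
  qed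
  then have "(\<Sum>C\<in>symmetric_mats n. ?F (C + D))
      = \<psi> a * \<psi> (1 / a * (b \<bullet> b)) * det_trace_sum n (d / a)"
    unfolding sum_distrib_left det_trace_sum_def by (intro sum.cong refl)
  then show ?thesis by (simp only: sum_symmetric_mats_shift[OF D, of ?F])
qed

lemma det_trace_sum_Suc:
  assumes d: "d \<noteq> 0"
  shows "det_trace_sum (Suc n) d
    = (\<Sum>a\<in>UNIV - {0}. \<psi> a * (of_real (qchar a) * gauss_sum) ^ n * det_trace_sum n (d / a))"
proof -
  define G where "G a = (\<Sum>b\<in>carrier_vec n. \<Sum>C\<in>symmetric_mats n.
      if det (bordered a b C) = d then \<psi> (trace_mat (bordered a b C)) else 0)" for a
  have "G 0 = 0"
    unfolding G_def by (intro sum.neutral ballI bordered_sum_zero_corner[OF d])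
  then have "det_trace_sum (Suc n) d = (\<Sum>a\<in>UNIV - {0}. G a)"
    unfolding det_trace_sum_def sum_symmetric_mats_Suc G_def[symmetric] by (simp add: sum_diff1)
  also have "\<dots> = (\<Sum>a\<in>UNIV - {0}. \<psi> a * (of_real (qchar a) * gauss_sum) ^ n * det_trace_sum n (d / a))"
  proof (intro sum.cong refl)
    fix a :: 'a assume "a \<in> UNIV - {0}"
    then have a: "a \<noteq> 0" by simp
    have "G a = (\<Sum>b\<in>carrier_vec n. \<psi> a * \<psi> (1 / a * (b \<bullet> b)) * det_trace_sum n (d / a))"
      unfolding G_def by (intro sum.cong refl bordered_sum_nonzero_corner[OF a])
    also have "\<dots> = \<psi> a * (\<Sum>b\<in>carrier_vec n. \<psi> (1 / a * (b \<bullet> b))) * det_trace_sum n (d / a)"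
      by (simp only: sum_distrib_left sum_distrib_right)
    also have "(\<Sum>b\<in>carrier_vec n. \<psi> (1 / a * (b \<bullet> b))) = (of_real (qchar a) * gauss_sum) ^ n"
      using a sum_psi_square[of "1 / a"] qchar_divide[OF two_nonzero, of 1 a]
      unfolding sum_psi_scalar_prod by simp
    finally show "G a = \<psi> a * (of_real (qchar a) * gauss_sum) ^ n * det_trace_sum n (d / a)" .
  qed
  finally show ?thesis .
qed

text \<open>
  In two steps with corners \<open>a\<close> and \<open>x\<close>, the quadratic character occurs as \<open>qchar a ^ (n + 1)\<close> and
  \<open>qchar x ^ n\<close>. For odd \<open>n\<close> the former is trivial and the latter is \<open>qchar x\<close>, so that collecting the terms
  with \<open>x * a = c\<close> gives the Salie sum at \<open>c\<close>.
\<close>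

lemma det_trace_sum_Suc_Suc:
  assumes d: "d \<noteq> 0" and n: "odd n"
  shows "det_trace_sum (Suc (Suc n)) d
    = gauss_sum ^ (2 * n + 1) * (\<Sum>c\<in>UNIV - {0}. salie_sum c * det_trace_sum n (d / c))"
proof -
  define F where "F x c = of_real (qchar x) * \<psi> (x + c / x) * det_trace_sum n (d / c)" for x c
  have "det_trace_sum (Suc (Suc n)) d = (\<Sum>a\<in>UNIV - {0}. \<Sum>x\<in>UNIV - {0}. gauss_sum ^ (2 * n + 1) * F x (x * a))"
    unfolding det_trace_sum_Suc[OF d]
  proof (intro sum.cong refl)
    fix a :: 'a assume "a \<in> UNIV - {0}"
    then have a: "a \<noteq> 0" by simp
    have "even (Suc n)" using n by simp
    from qchar_power_even[OF a this] have qa: "complex_of_real (qchar a) ^ Suc n = 1"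
      by (simp only: of_real_power [symmetric] of_real_1)
    have IH: "det_trace_sum (Suc n) (d / a)
        = (\<Sum>x\<in>UNIV - {0}. \<psi> x * (of_real (qchar x) * gauss_sum) ^ n * det_trace_sum n (d / a / x))"
      using a d by (intro det_trace_sum_Suc) simp
    show "\<psi> a * (of_real (qchar a) * gauss_sum) ^ Suc n * det_trace_sum (Suc n) (d / a)
        = (\<Sum>x\<in>UNIV - {0}. gauss_sum ^ (2 * n + 1) * F x (x * a))"
      unfolding IH sum_distrib_left
    proof (intro sum.cong refl)
      fix x :: 'a assume "x \<in> UNIV - {0}"
      then have x: "x \<noteq> 0" by simp
      from qchar_power_odd[OF x n] have "complex_of_real (qchar x) ^ n = of_real (qchar x)"
        by (simp only: of_real_power [symmetric])
      moreover have "gauss_sum ^ (2 * n + 1) = gauss_sum ^ Suc n * gauss_sum ^ n"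
        by (simp flip: power_add add: mult_2)
      ultimately show "\<psi> a * (of_real (qchar a) * gauss_sum) ^ Suc n
            * (\<psi> x * (of_real (qchar x) * gauss_sum) ^ n * det_trace_sum n (d / a / x))
          = gauss_sum ^ (2 * n + 1) * F x (x * a)"
        using x unfolding F_def power_mult_distrib qa
        by (simp add: psi_add mult_ac del: power_Suc)
    qed
  qed
  also have "\<dots> = gauss_sum ^ (2 * n + 1) * (\<Sum>x\<in>UNIV - {0}. \<Sum>a\<in>UNIV - {0}. F x (x * a))"
    by (subst sum.swap) (simp only: sum_distrib_left)
  also have "(\<Sum>x\<in>UNIV - {0}. \<Sum>a\<in>UNIV - {0}. F x (x * a)) = (\<Sum>x\<in>UNIV - {0}. \<Sum>c\<in>UNIV - {0}. F x c)"
  proof (rule sum.cong[OF refl])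
    fix x :: 'a assume x: "x \<in> UNIV - {0}"
    then have "bij_betw (\<lambda>a. x * a) (UNIV - {0}) (UNIV - {0})"
      by (intro bij_betw_byWitness[of _ "\<lambda>c. c / x"]) auto
    then show "(\<Sum>a\<in>UNIV - {0}. F x (x * a)) = (\<Sum>c\<in>UNIV - {0}. F x c)"
      by (rule sum.reindex_bij_betw)
  qed
  also have "\<dots> = (\<Sum>c\<in>UNIV - {0}. salie_sum c * det_trace_sum n (d / c))"
    by (subst sum.swap) (simp add: F_def salie_sum_def sum_distrib_right)
  finally show ?thesis .
qed

text \<open>
  With \<open>n = 2 * m + 1\<close>, the inductive step multiplies the bound by
  \<open>\<bar>g\<bar> ^ (2 * n + 1) * (\<bar>g\<bar> * (q - 1)) = q ^ (n + 1) * (q - 1)\<close>, where \<open>g\<close> is the Gauss sum.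
\<close>

lemma norm_det_trace_sum_le:
  assumes "d \<noteq> 0"
  shows "norm (det_trace_sum (2 * m + 1) d) \<le> real CARD('a) ^ (m * (m + 1)) * (real CARD('a) - 1) ^ m"
  using assms
proof (induction m arbitrary: d)
  case 0
  have "det_trace_sum 1 d = (\<Sum>a\<in>UNIV - {0}. if a = d then \<psi> a else 0)"
    unfolding One_nat_def det_trace_sum_Suc[OF 0]
    by (intro sum.cong refl) (auto simp: det_trace_sum_def symmetric_mats_0 trace_mat_def)
  also have "\<dots> = \<psi> d" using 0 by simp
  finally show ?case by simp
next
  case (Suc m)
  define q where "q = real CARD('a)"
  define B where "B = q ^ (m * (m + 1)) * (q - 1) ^ m"
  have "1 \<le> q" unfolding q_def by (simp add: Suc_leI)
  then have B: "B \<ge> 0" by (simp add: B_def)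
  have g: "norm gauss_sum ^ 2 = q" by (simp add: norm_gauss_sum q_def)
  have "norm (\<Sum>c\<in>UNIV - {0}. salie_sum c * det_trace_sum (2 * m + 1) (d / c))
      \<le> (\<Sum>c\<in>UNIV - {0}. norm (salie_sum c) * B)"
    using Suc by (intro sum_norm_le) (auto simp: norm_mult B_def q_def intro!: mult_left_mono)
  also have "\<dots> = (\<Sum>c\<in>UNIV - {0}. norm (salie_sum c)) * B" by (simp add: sum_distrib_right)
  also have "\<dots> \<le> norm gauss_sum * (q - 1) * B"
    unfolding q_def by (intro mult_right_mono sum_norm_salie_sum_le B)
  finally have step: "norm (\<Sum>c\<in>UNIV - {0}. salie_sum c * det_trace_sum (2 * m + 1) (d / c))
      \<le> norm gauss_sum * (q - 1) * B" .
  have "2 * Suc m + 1 = Suc (Suc (2 * m + 1))" by simp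
  then have "norm (det_trace_sum (2 * Suc m + 1) d) = norm gauss_sum ^ (2 * (2 * m + 1) + 1)
      * norm (\<Sum>c\<in>UNIV - {0}. salie_sum c * det_trace_sum (2 * m + 1) (d / c))"
    using det_trace_sum_Suc_Suc[OF Suc.prems, of "2 * m + 1"]
    by (simp add: norm_mult norm_power del: power_Suc)
  also have "\<dots> \<le> norm gauss_sum ^ (2 * (2 * m + 1) + 1) * (norm gauss_sum * (q - 1) * B)"
    by (intro mult_left_mono step) simp
  also have "\<dots> = (norm gauss_sum ^ 2) ^ (2 * m + 2) * (q - 1) * B"
  proof -
    have "norm gauss_sum ^ (2 * (2 * m + 1) + 1) * norm gauss_sum = norm gauss_sum ^ (2 * (2 * m + 2))"
      by (simp add: power_Suc2 [symmetric] del: power_Suc)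
    then show ?thesis by (simp only: power_mult mult.assoc [symmetric])
  qed
  also have "\<dots> = q ^ (Suc m * (Suc m + 1)) * (q - 1) ^ Suc m"
  proof -
    have "2 * m + 2 + m * (m + 1) = Suc m * (Suc m + 1)" by simp
    then have "q ^ (2 * m + 2) * q ^ (m * (m + 1)) = q ^ (Suc m * (Suc m + 1))"
      by (simp only: power_add [symmetric])
    then show ?thesis unfolding g B_def by (simp only: power_Suc mult_ac)
  qed
  finally show ?case by (simp add: q_def)
qed

end

section \<open>Counting symmetric matrices by determinant and trace\<close>

lemma two_nonzero_if_odd_card:
  assumes "\<not> 2 dvd CARD('a :: {field, finite})"
  shows "(2 :: 'a) \<noteq> 0"
proof
  assume "(2 :: 'a) = 0"
  then have "CHAR('a) dvd 2" using of_nat_eq_0_iff_char_dvd[where 'a='a, of 2] by simp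
  then have "CHAR('a) = 2" using CHAR_not_1'[where 'a='a] by (metis One_nat_def prime_nat_iff two_is_prime_nat)
  then show False using assms CHAR_dvd_CARD[where 'a='a] by simp
qed

lemma transpose_smult_mat: "transpose_mat (r \<cdot>\<^sub>m A) = r \<cdot>\<^sub>m transpose_mat A"
  by (rule eq_matI) auto

lemma symmetric_mats_congruence:
  fixes A E :: "'a :: comm_ring_1 mat"
  assumes "A \<in> symmetric_mats n" "E \<in> symmetric_mats n"
  shows "r \<cdot>\<^sub>m (E * A * E) \<in> symmetric_mats n"
proof -
  have A: "A \<in> carrier_mat n n" "transpose_mat A = A" and E: "E \<in> carrier_mat n n" "transpose_mat E = E"
    using assms by (simp_all add: symmetric_mats_def)
  have EA: "E * A \<in> carrier_mat n n" using A E by simp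
  have "transpose_mat (E * A * E) = E * (A * E)"
    by (simp only: transpose_mult[OF EA E(1)] transpose_mult[OF E(1) A(1)] A(2) E(2))
  also have "\<dots> = E * A * E" by (rule assoc_mult_mat[symmetric, OF E(1) A(1) E(1)])
  finally have "transpose_mat (r \<cdot>\<^sub>m (E * A * E)) = r \<cdot>\<^sub>m (E * A * E)"
    using transpose_smult_mat[of r "E * A * E"] by simp
  then show ?thesis using EA E(1) by (simp add: symmetric_mats_def)
qed

text \<open>
  With \<open>E\<close> the diagonal matrix with entries \<open>r\<^sup>-\<^sup>m, 1, \<dots>, 1\<close>, the injective map
  \<open>A \<mapsto> r \<cdot> E A E\<close> multiplies the determinant by \<open>r\<^sup>2\<^sup>m\<^sup>+\<^sup>1 * r\<^sup>-\<^sup>2\<^sup>m = r\<close>. Here the odd size of the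
  matrices matters: for even size, scalars and congruences change the determinant by squares only.
\<close>

lemma card_det_le_card_det_mult:
  fixes d r :: "'a :: {field, finite}"
  assumes r: "r \<noteq> 0"
  shows "card {A \<in> symmetric_mats (2 * m + 1). det A = d}
    \<le> card {A \<in> symmetric_mats (2 * m + 1). det A = r * d}"
proof -
  define n where "n = 2 * m + 1"
  define E where "E = multrow_mat n 0 (inverse r ^ m)"
  define F where "F = multrow_mat n 0 (r ^ m)"
  have n: "0 < n" by (simp add: n_def)
  have E: "E \<in> carrier_mat n n" and F: "F \<in> carrier_mat n n" by (simp_all add: E_def F_def)
  have Es: "E \<in> symmetric_mats n" unfolding E_def by (simp add: symmetric_mats_iff)
  have detE: "det E = inverse r ^ m" unfolding E_def by (rule det_multrow_mat[OF n])
  have FE: "F * E = 1\<^sub>m n" "E * F = 1\<^sub>m n"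
    using multrow_mat_inv[OF n, of "r ^ m"] multrow_mat_inv[OF n, of "inverse r ^ m"] r
    by (simp_all add: E_def F_def power_inverse)
  define f where "f A = r \<cdot>\<^sub>m (E * A * E)" for A
  have f_inv: "inverse r \<cdot>\<^sub>m (F * f A * F) = A" if A: "A \<in> carrier_mat n n" for A
  proof -
    have EA: "E * A \<in> carrier_mat n n" and EAE: "E * A * E \<in> carrier_mat n n" using A E by simp_all
    have "F * f A * F = r \<cdot>\<^sub>m (F * (E * A * E) * F)"
      unfolding f_def using EAE F by (simp add: mult_smult_distrib[of _ n n _ n] mult_smult_assoc_mat[of _ n n _ n])
    also have "F * (E * A * E) * F = F * (E * A * E * F)"
      by (rule assoc_mult_mat[OF F EAE F])
    also have "E * A * E * F = E * A"
      by (simp only: assoc_mult_mat[OF EA E F] FE(2) right_mult_one_mat[OF EA])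
    also have "F * (E * A) = A"
      by (simp only: assoc_mult_mat[OF F E A, symmetric] FE(1) left_mult_one_mat[OF A])
    finally have "F * f A * F = r \<cdot>\<^sub>m A" .
    then show ?thesis using r by (intro eq_matI) simp_all
  qed
  have "inj_on f (carrier_mat n n)"
    by (rule inj_on_inverseI) (rule f_inv)
  then have inj: "inj_on f {A \<in> symmetric_mats n. det A = d}"
    by (rule inj_on_subset) (auto dest: symmetric_mats_carrier)
  have image: "f ` {A \<in> symmetric_mats n. det A = d} \<subseteq> {A \<in> symmetric_mats n. det A = r * d}"
  proof clarify
    fix A :: "'a mat" assume A: "A \<in> symmetric_mats n"
    note A' = symmetric_mats_carrier[OF A]
    have "det (f A) = r ^ n * (det E * det A * det E)"
      unfolding f_def using A' E by (simp add: det_mult[of _ n])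
    also have "\<dots> = r * det A"
    proof -
      have "r ^ n = r ^ m * r ^ m * r"
        by (simp only: n_def power_add power_even_eq power2_eq_square power_one_right)
      moreover have "r ^ m * inverse r ^ m = 1"
        using r by (simp add: power_inverse)
      moreover have "x * x * r * (y * z * y) = r * z" if "x * y = 1" for x y z :: 'a
      proof -
        have "x * x * r * (y * z * y) = (x * y) * (x * y) * (r * z)" by (simp only: mult_ac)
        then show ?thesis using that by simp
      qed
      ultimately show ?thesis unfolding detE by presburger
    qed
    finally have "det (f A) = r * det A" .
    moreover have "f A \<in> symmetric_mats n"
      unfolding f_def by (rule symmetric_mats_congruence[OF A Es])
    ultimately show "f A \<in> symmetric_mats n \<and> det (f A) = r * det A" by blast
  qed
  show ?thesis
    using card_inj_on_le[OF inj image] by (simp add: n_def)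
qed

lemma card_symmetric_GL:
  fixes d :: "'a :: {field, finite}"
  assumes d: "d \<noteq> 0"
  shows "card (symmetric_GL (2 * m + 1) :: 'a mat set)
    = (CARD('a) - 1) * card {A \<in> symmetric_mats (2 * m + 1). det A = d}"
proof -
  define N where "N e = card {A \<in> symmetric_mats (2 * m + 1). det A = e}" for e :: 'a
  have "N e = N d" if e: "e \<noteq> 0" for e
    using card_det_le_card_det_mult[of "e / d" m d] card_det_le_card_det_mult[of "d / e" m e] d e
    by (simp add: N_def)
  moreover have "card (symmetric_GL (2 * m + 1) :: 'a mat set) = (\<Sum>e\<in>UNIV - {0}. N e)"
  proof -
    have "symmetric_GL (2 * m + 1) = (\<Union>e\<in>UNIV - {0 :: 'a}. {A \<in> symmetric_mats (2 * m + 1). det A = e})"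
      unfolding symmetric_GL_eq by auto
    then show ?thesis
      unfolding N_def by (simp only:) (rule card_UN_disjoint; auto)
  qed
  ultimately show ?thesis by (simp add: N_def card_Diff_subset)
qed

theorem theorem1p0p4:
  fixes q :: nat and d t :: "'a :: {field, finite}" and m :: nat
  assumes "primepow q" and "\<not> 2 dvd q" and "\<not> 3 dvd q"
    and "CARD('a) = q"
    and "d \<noteq> 0"
  shows "\<bar>real (card {A \<in> symmetric_GL (2 * m + 1). (det A, trace_mat A) = (d, t)})
            - real (card (symmetric_GL (2 * m + 1) :: 'a mat set)) / (real q * (real q - 1))\<bar>
          \<le> real q ^ (m * (m + 1)) * (real q - 1) ^ (m + 1)"
proof -
  have two: "(2 :: 'a) \<noteq> 0" using assms by (intro two_nonzero_if_odd_card) simp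
  obtain \<psi> :: "'a \<Rightarrow> complex" where "additive_character \<psi>" using ex_additive_character by blast
  then interpret additive_character \<psi> .
  define S where "S = {A \<in> symmetric_mats (2 * m + 1). det A = d}"
  define N where "N = card {A \<in> S. trace_mat A = t}"
  define B where "B = real q ^ (m * (m + 1)) * (real q - 1) ^ m"
  have fin: "finite S" by (simp add: S_def)
  have "card {0 :: 'a, 1} \<le> CARD('a)" by (rule card_mono) simp_all
  then have q: "q \<ge> 2" using assms(4) by simp
  have eq: "{A \<in> symmetric_GL (2 * m + 1). (det A, trace_mat A) = (d, t)} = {A \<in> S. trace_mat A = t}"
    using assms(5) by (auto simp: symmetric_GL_eq S_def)
  have twist: "norm (\<Sum>A\<in>S. \<psi> (a * (trace_mat A - t))) \<le> B" if a: "a \<noteq> 0" for a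
  proof -
    interpret tw: odd_additive_character "\<lambda>x. \<psi> (a * x)"
      by (intro odd_additive_character.intro psi_scale[OF a] odd_additive_character_axioms.intro two)
    have "(\<Sum>A\<in>S. \<psi> (a * (trace_mat A - t))) = \<psi> (- (a * t)) * tw.det_trace_sum (2 * m + 1) d"
      unfolding tw.det_trace_sum_def S_def
      by (simp add: sum.inter_filter sum_distrib_left right_diff_distrib if_distrib flip: psi_add cong: if_cong)
    then show ?thesis
      using tw.norm_det_trace_sum_le[OF assms(5), of m] assms(4) by (simp add: norm_mult B_def)
  qed
  \<comment> \<open>summing over all characters detects the condition on the trace\<close>
  have "(\<Sum>a\<in>UNIV. \<Sum>A\<in>S. \<psi> (a * (trace_mat A - t))) = (\<Sum>A\<in>S. \<Sum>a\<in>UNIV. \<psi> ((trace_mat A - t) * a))"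
    by (subst sum.swap) (simp only: mult.commute)
  also have "\<dots> = (\<Sum>A\<in>S. if trace_mat A = t then of_nat q else 0)"
    unfolding sum_psi_mult assms(4) by simp
  also have "\<dots> = of_nat (q * N)"
    using fin by (simp add: N_def sum.inter_filter [symmetric])
  finally have "of_nat (q * N) = (\<Sum>a\<in>UNIV. \<Sum>A\<in>S. \<psi> (a * (trace_mat A - t)))" ..
  also have "\<dots> = of_nat (card S) + (\<Sum>a\<in>UNIV - {0}. \<Sum>A\<in>S. \<psi> (a * (trace_mat A - t)))"
    by (subst sum.remove[of _ 0]) simp_all
  finally have "complex_of_real (real q * real N - real (card S))
      = (\<Sum>a\<in>UNIV - {0}. \<Sum>A\<in>S. \<psi> (a * (trace_mat A - t)))"
    by simp
  then have "\<bar>real q * real N - real (card S)\<bar>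
      = norm (\<Sum>a\<in>UNIV - {0}. \<Sum>A\<in>S. \<psi> (a * (trace_mat A - t)))"
    by (metis norm_of_real real_norm_def)
  also have "\<dots> \<le> (\<Sum>a\<in>UNIV - {0 :: 'a}. B)"
    by (intro sum_norm_le twist) simp
  also have "\<dots> = (real q - 1) * B"
    using q assms(4) by (simp add: card_Diff_subset of_nat_diff)
  finally have bound: "\<bar>real q * real N - real (card S)\<bar> \<le> (real q - 1) * B" .
  have "real (card (symmetric_GL (2 * m + 1) :: 'a mat set)) = (real q - 1) * real (card S)"
    unfolding card_symmetric_GL[OF assms(5)] S_def assms(4) using q by (simp add: of_nat_diff)
  then have "real (card (symmetric_GL (2 * m + 1) :: 'a mat set)) / (real q * (real q - 1)) = real (card S) / real q"
    using q by simp
  then have "real N - real (card (symmetric_GL (2 * m + 1) :: 'a mat set)) / (real q * (real q - 1))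
      = (real q * real N - real (card S)) / real q"
    using q by (simp add: diff_divide_distrib)
  then have "\<bar>real N - real (card (symmetric_GL (2 * m + 1) :: 'a mat set)) / (real q * (real q - 1))\<bar>
      = \<bar>real q * real N - real (card S)\<bar> / real q"
    by simp
  also have "\<dots> \<le> \<bar>real q * real N - real (card S)\<bar> / 1"
    using q by (intro divide_left_mono) simp_all
  also have "\<dots> \<le> (real q - 1) * B" using bound by simp
  also have "\<dots> = real q ^ (m * (m + 1)) * (real q - 1) ^ (m + 1)"
    by (simp add: B_def)
  finally show ?thesis unfolding eq N_def .
qed

end
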